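(* Let $\beta>0$, $c\ge 0$, $\sigma\ge0$, $\beta^k=\beta/(\tau^k)^2$ and $c^k=c(1-\tau^k)\beta^k/\tau^k$ for all $k\ge 0$, where $\tau^k>0$, $1/(\tau^{k-1})^2=(1-\tau^k)/(\tau^k)^2$ for $k\ge 0$ and $\tau^{-1}\in(0,1)$. Let $x'\in\Omega$ and $\lambda\in\mathbb{R}^l$. Suppose that $\{\breve x^k\}$, $\{\widetilde u^k\}$, $\{v^k\}$, $\{z^k\}$ are generated by the following prediction-correction framework: for every $k\ge 0$, with given $\breve x^{k-1}$ and $v^k$, the points $\breve x^k$ and $\widetilde u^k=(\widetilde x^k,\widetilde\lambda^k)$ satisfy $\widetilde x^k=\frac{1}{\tau^k}\breve x^k-\frac{1-\tau^k}{\tau^k}\breve x^{k-1}$ and $$\frac{1}{(\tau^k)^2}[f(x)-f(\breve x^k)]-\frac{1}{(\tau^{k-1})^2}[f(x)-f(\breve x^{k-1})]+\frac1{\tau^k}(u-\widetilde u^k)^TF(\widetilde u^k)+c^k(A(x-\widetilde x^k))^T(A\breve x^{k-1}-b)$$ $$\ge \frac1{\tau^k}\Big[(v-\widetilde v^k)^TQ^k(v^k-\widetilde v^k)+\frac{\sigma}{2}\|z^k-z\|_R^2\Big]\quad\forall u,$$ and $v^{k+1}=v^k-M^k(v^k-\widetilde v^k)$. Suppose that for each $k$ there exists a matrix $H^k$ with $Q^k=H^kM^k$, and put $G^k:=(Q^k)^T+Q^k-(M^k)^TH^kM^k$. Suppose further that there are matrices $H_0^k\succeq 0$ and numbers $\varTheta^k\ge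 0$ such that for all $k\ge 0$ $$\frac1{\tau^k}\left(\|v^{k+1}-v'\|^2_{H^k}+\sigma\|z^k-z'\|_R^2-\|v^k-v'\|^2_{H^k}+\|v^k-\widetilde v^k\|^2_{G^k}\right)\ \ge\ \|v^{k+1}-v'\|^2_{H_0^{k+1}}-\|v^k-v'\|^2_{H_0^k}+\varTheta^{k+1}-\varTheta^k$$ and $\varTheta^{k+1}-\varTheta^k\ge c\,\beta^k\|A\widetilde x^k-b\|^2$. Then $$f(\breve x^k)-f(x')-\lambda^T(A\breve x^k-b)\le O(1/k^2),$$ i.e. there is a constant $C$ independent of $k$ such that the left-hand side is at most $C/k^2$ for all $k\ge 1$.
   Context: Problem: minimize $f(x)$ subject to $Ax=b$, with $f:\mathbb{R}^n\to\mathbb{R}$ closed, proper, convex, $A\in\mathbb{R}^{l\times n}$, $b\in\mathbb{R}^l$; $\Omega=\{x:Ax=b\}$. It is considered in one of three forms: (P1) no further structure; (P2) $x=(x_1,x_2)$, $f(x)=f_1(x_1)+f_2(x_2)$, $Ax=A_1x_1+A_2x_2$; (P3) $x=(x_1,\dots,x_m)$, $m\ge2$, $f(x)=\sum_{i=1}^m f_i(x_i)$, $Ax=\sum_{i=1}^m A_ix_i$, all $f_i$ closed proper convex real-valued. For $x\in\mathbb{R}^n$, $\lambda\in\mathbb{R}^l$ put $u=(x,\lambda)$ and $F(u)=(-A^T\lambda,\ Ax-b)$. The vector $v$ associated with $u$ is $v=(x,\lambda)$ for (P1), $v=(x_2,\lambda)$ for (P2), and $v=(A_2x_2,\dots,A_mx_m,\lambda)$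 for (P3). Likewise $\widetilde v^k$ is the vector associated with $\widetilde u^k$, and $v'$ is the vector associated with $u'=(x',\lambda)$. The auxiliary variable $z$ is a fixed function of $x$ (for instance $z=x$, $z=x_i$, or $z=\nabla f_i(x_i)$), $z'$ is its value at $x'$, $z^k$ are given vectors in the same space, and $R\succeq0$. The $v^k$ are vectors in the same space as $v$ ($v^0$ and $\breve x^{-1}$ are given), and $Q^k,M^k,H^k,H_0^k$ are real square matrices of matching size; $Q^k$ need not be symmetric. $\|w\|_D^2:=w^TDw$, whether or not $D$ is positive semidefinite.
   Formalization: The matrices H^k are additionally assumed symmetric; without this the statement is false (a skew-symmetric H^k gives a counterexample with f(x)=x_1, A=0, c=σ=0). *)

theory Defs
  imports "HOL-Analysis.Analysis"
begin

text \<open>Properness is automatic: \<open>f\<close> is real-valued, and all the sets \<open>S\<close> used below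
  contain \<open>0\<close>. Closedness is closedness of the epigraph.\<close>

definition closed_proper_convex_on :: "'a::euclidean_space set \<Rightarrow> ('a \<Rightarrow> real) \<Rightarrow> bool"
  where "closed_proper_convex_on S f \<longleftrightarrow> convex_on S f \<and> closed (epigraph S f)"

definition feasible :: "real^'n^'l \<Rightarrow> real^'l \<Rightarrow> (real^'n) set"
  where "feasible A b = {x. A *v x = b}"

definition saddle_op ::
    "real^'n^'l \<Rightarrow> real^'l \<Rightarrow> (real^'n) \<times> (real^'l) \<Rightarrow> (real^'n) \<times> (real^'l)"
  where "saddle_op A b u = (- (transpose A *v snd u), A *v fst u - b)"

definition sqnorm_mat :: "real^'d^'d \<Rightarrow> real^'d \<Rightarrow> real"
  where "sqnorm_mat D w = w \<bullet> (D *v w)"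

text \<open>Symmetry is not required: as a hypothesis this is the weaker of the two common readings
  of \<open>D \<succeq> 0\<close>.\<close>

definition psd :: "real^'d^'d \<Rightarrow> bool"
  where "psd D \<longleftrightarrow> (\<forall>w. 0 \<le> sqnorm_mat D w)"

text \<open>A splitting \<open>x = (x_1, \<dots>, x_m)\<close> into blocks of arbitrary sizes is given by the map
  \<open>blk\<close> that sends each coordinate of \<open>x\<close> to the number of its block. The space of the
  \<open>i\<close>-th block is identified with the coordinate subspace \<open>block_space blk i\<close>, and
  \<open>x_i\<close> with \<open>block blk i x\<close>. The matrix \<open>A_i\<close> consists of the columns of \<open>A\<close>
  that belong to block \<open>i\<close>, so \<open>A_i x_i\<close> is \<open>A *v block blk i x\<close>.\<close>

definition block_space :: "('n \<Rightarrow> nat) \<Rightarrow> nat \<Rightarrow> (real^'n) set"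
  where "block_space blk i = {x. \<forall>j. blk j \<noteq> i \<longrightarrow> x $ j = 0}"

definition block :: "('n \<Rightarrow> nat) \<Rightarrow> nat \<Rightarrow> real^'n \<Rightarrow> real^'n"
  where "block blk i x = (\<chi> j. if blk j = i then x $ j else 0)"

definition block_separable :: "nat \<Rightarrow> ('n \<Rightarrow> nat) \<Rightarrow> (real^'n \<Rightarrow> real) \<Rightarrow> bool"
  where "block_separable m blk f \<longleftrightarrow>
    range blk = {1..m} \<and>
    (\<exists>fs. (\<forall>i\<in>{1..m}. closed_proper_convex_on (block_space blk i) (fs i)) \<and>
          (\<forall>x. f x = (\<Sum>i=1..m. fs i (block blk i x))))"

text \<open>The vector \<open>v\<close> associated with \<open>u = (x, \<lambda>)\<close> is a function \<open>vv\<close> of \<open>u\<close> with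
  values in \<open>real^'w\<close>. Its length, i.e. \<open>CARD('w)\<close>, depends on the form of the problem;
  the bijection \<open>e\<close> from the coordinates of the concatenated vector onto \<open>'w\<close>
  lays them out in \<open>'w\<close>.\<close>

definition one_block_form :: "((real^'n) \<times> (real^'l) \<Rightarrow> real^'w) \<Rightarrow> bool"
  where "one_block_form vv \<longleftrightarrow>
    (\<exists>e :: 'n + 'l \<Rightarrow> 'w. bij e \<and>
      (\<forall>x y. (\<forall>j. vv (x, y) $ e (Inl j) = x $ j) \<and>
             (\<forall>r. vv (x, y) $ e (Inr r) = y $ r)))"

definition two_block_form ::
    "(real^'n \<Rightarrow> real) \<Rightarrow> ((real^'n) \<times> (real^'l) \<Rightarrow> real^'w) \<Rightarrow> bool"
  where "two_block_form f vv \<longleftrightarrow>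
    (\<exists>blk (e :: 'n + 'l \<Rightarrow> 'w).
      block_separable 2 blk f \<and>
      bij_betw e ({j. blk j = 2} <+> UNIV) UNIV \<and>
      (\<forall>x y. (\<forall>j. blk j = 2 \<longrightarrow> vv (x, y) $ e (Inl j) = x $ j) \<and>
             (\<forall>r. vv (x, y) $ e (Inr r) = y $ r)))"

definition multi_block_form ::
    "(real^'n \<Rightarrow> real) \<Rightarrow> real^'n^'l \<Rightarrow> ((real^'n) \<times> (real^'l) \<Rightarrow> real^'w) \<Rightarrow> bool"
  where "multi_block_form f A vv \<longleftrightarrow>
    (\<exists>m blk (e :: nat \<times> 'l + 'l \<Rightarrow> 'w).
      m \<ge> 2 \<and> block_separable m blk f \<and>
      bij_betw e (({2..m} \<times> UNIV) <+> UNIV) UNIV \<and>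
      (\<forall>x y. (\<forall>i\<in>{2..m}. \<forall>r. vv (x, y) $ e (Inl (i, r)) = (A *v block blk i x) $ r) \<and>
             (\<forall>r. vv (x, y) $ e (Inr r) = y $ r)))"

end

theory Submission
  imports Defs
begin

text \<open>Write \<open>r k = A *v xb k - b\<close> and \<open>L k = f (xb k) - f x' - lam \<bullet> r k\<close>. At \<open>u = (x', lam)\<close> the
  prediction inequality, the polarisation identity for \<open>H k\<close> and the convergence condition show that
  the energy \<open>E k = L k / (\<tau> k)\<^sup>2 + c * \<beta> / 2 * (norm (r k))\<^sup>2 / (\<tau> k) ^ 4 + W (k + 1) / 2\<close>, where
  \<open>W k = sqnorm_mat (H\<^sub>0 k) (v k - vv (x', lam))\<close>, is nonincreasing; the growth of \<open>\<Theta>\<close>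
  absorbs the term in \<open>A *v fst (ut k) - b\<close>. Hence \<open>L k \<le> (\<tau> k)\<^sup>2 * E (- 1)\<close>, and the
  recursion for \<open>\<tau>\<close> makes \<open>1 / \<tau> k\<close> grow by at least \<open>1 / 2\<close> in each step.\<close>

text \<open>The linear part of \<open>saddle_op\<close> is skew-symmetric, so the terms pairing
  \<open>snd u\<close> with the residual cancel once \<open>A *v x\<close> is replaced by
  \<open>b\<close>.\<close>

lemma inner_saddle_op_feasible:
  assumes "A *v x = b"
  shows "((x, y) - u) \<bullet> saddle_op A b u = y \<bullet> (A *v fst u - b)"
proof -
  have "(x - fst u) \<bullet> (transpose A *v snd u) = snd u \<bullet> (A *v (x - fst u))"
    by (metis dot_lmul_matrix inner_commute transpose_matrix_vector transpose_transpose)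
  then show ?thesis
    using assms
    by (cases u)
      (simp add: saddle_op_def inner_prod_def matrix_vector_mult_diff_distrib algebra_simps
        inner_diff_left inner_diff_right)
qed

lemma inner_matrix_symmetric:
  fixes H :: "real^'d^'d"
  assumes "transpose H = H"
  shows "x \<bullet> (H *v y) = y \<bullet> (H *v x)"
  using assms by (metis dot_lmul_matrix inner_commute transpose_matrix_vector)

lemma inner_transpose_mult:
  fixes M :: "real^'d^'d"
  shows "x \<bullet> (transpose M *v y) = (M *v x) \<bullet> y"
  by (metis dot_lmul_matrix inner_commute transpose_matrix_vector)

text \<open>With \<open>a = p - s\<close> and \<open>d = M *v a\<close>, the factorisation of
  \<open>Q\<close> turns every term into a pairing with \<open>H *v d\<close>. Expanding the
  \<open>H\<close>-form at \<open>(p - w) - d\<close> leaves a surplus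
  \<open>d \<bullet> (H *v d)\<close>, which the subtracted term of \<open>G\<close> removes;
  symmetry of \<open>H\<close> merges the two cross terms.\<close>

lemma correction_polarisation:
  fixes H M Q G :: "real^'d^'d"
  assumes sym: "transpose H = H" and Q: "Q = H ** M"
    and G: "G = transpose Q + Q - transpose M ** H ** M"
    and q: "q = p - M *v (p - s)"
  shows "2 * ((w - s) \<bullet> (Q *v (p - s))) =
    sqnorm_mat H (q - w) - sqnorm_mat H (p - w) + sqnorm_mat G (p - s)"
proof -
  define a where "a = p - s"
  define d where "d = M *v a"
  define e where "e = p - w"
  have Qa: "Q *v a = H *v d"
    by (simp add: Q d_def matrix_vector_mul_assoc)
  have "a \<bullet> (transpose Q *v a) = a \<bullet> (H *v d)"
    by (metis inner_transpose_mult inner_commute Qa)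
  moreover have "a \<bullet> ((transpose M ** H ** M) *v a) = d \<bullet> (H *v d)"
    by (metis d_def inner_transpose_mult matrix_vector_mul_assoc)
  ultimately have Ga: "sqnorm_mat G a = 2 * (a \<bullet> (H *v d)) - d \<bullet> (H *v d)"
    by (simp add: sqnorm_mat_def G matrix_vector_mult_add_rdistrib
        matrix_vector_mult_diff_rdistrib inner_add_right inner_diff_right Qa)
  have "sqnorm_mat H (e - d) = sqnorm_mat H e - 2 * (e \<bullet> (H *v d)) + d \<bullet> (H *v d)"
    using inner_matrix_symmetric[OF sym, of d e]
    by (simp add: sqnorm_mat_def matrix_vector_mult_diff_distrib inner_diff_left inner_diff_right)
  moreover have "q - w = e - d" "w - s = a - e"
    by (simp_all add: q e_def d_def a_def)
  ultimately show ?thesis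
    using Qa Ga unfolding a_def[symmetric] e_def[symmetric] by (simp add: inner_diff_left)
qed

lemma inner_diff_polarisation:
  fixes p q :: "'a::real_inner"
  shows "(p - q) \<bullet> q = ((norm p)\<^sup>2 - (norm q)\<^sup>2 - (norm (p - q))\<^sup>2) / 2"
  by (simp add: power2_norm_eq_inner inner_diff_left inner_diff_right inner_commute)

text \<open>Complete the square: \<open>s\<^sup>2 - s\<close> is
  \<open>(s - 1 / 2)\<^sup>2 - 1 / 4\<close>. Positivity of \<open>t\<close> forces
  \<open>s \<ge> 1\<close>, so \<open>s - 1 / 2\<close> is nonnegative and roots can be compared.
  Applied with \<open>s = 1 / \<tau> k\<close> and \<open>t = 1 / \<tau> (k - 1)\<close>.\<close>

lemma step_size_growth:
  fixes s t :: real
  assumes "s > 0" "t > 0" and "t\<^sup>2 = s\<^sup>2 - s"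
  shows "t + 1 / 2 \<le> s"
proof -
  have "0 < s * (s - 1)"
    using zero_less_power[OF \<open>t > 0\<close>, of 2] unfolding assms(3)
    by (simp add: power2_eq_square right_diff_distrib)
  then have "s \<ge> 1"
    using \<open>s > 0\<close> by (simp add: zero_less_mult_iff)
  have "(s - 1 / 2)\<^sup>2 = t\<^sup>2 + 1 / 4"
    unfolding assms(3) by (simp add: power2_diff power_divide)
  then have "t\<^sup>2 \<le> (s - 1 / 2)\<^sup>2" by simp
  then have "t \<le> s - 1 / 2"
    by (rule power2_le_imp_le) (use \<open>s \<ge> 1\<close> in simp)
  then show ?thesis by simp
qed

lemma step_size_bound:
  fixes \<tau> :: "int \<Rightarrow> real"
  assumes pos: "\<And>k. k \<ge> - 1 \<Longrightarrow> \<tau> k > 0"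
    and rec: "\<And>k. k \<ge> 0 \<Longrightarrow> 1 / (\<tau> (k - 1))\<^sup>2 = (1 - \<tau> k) / (\<tau> k)\<^sup>2"
    and "k \<ge> 0"
  shows "real_of_int (k + 1) / 2 \<le> 1 / \<tau> k"
proof -
  have growth: "1 / \<tau> (k - 1) + 1 / 2 \<le> 1 / \<tau> k" if "k \<ge> 0" for k
  proof (rule step_size_growth)
    show "(1 / \<tau> (k - 1))\<^sup>2 = (1 / \<tau> k)\<^sup>2 - 1 / \<tau> k"
      using rec[OF that] pos[of k] that by (simp add: field_simps power2_eq_square)
  qed (use pos that in auto)
  show ?thesis
    using \<open>k \<ge> 0\<close>
  proof (induction k rule: int_ge_induct)
    case base
    \<comment> \<open>The increment from index -1 to 0 already counts, hence \<open>k + 1\<close>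
      rather than \<open>k\<close> in the bound.\<close>
    have "1 / \<tau> (- 1) + 1 / 2 \<le> 1 / \<tau> 0" using growth[of 0] by simp
    moreover have "0 < 1 / \<tau> (- 1)" using pos[of "- 1"] by simp
    ultimately have "1 / 2 \<le> 1 / \<tau> 0" by linarith
    then show ?case by simp
  next
    case (step i)
    then show ?case using growth[of "i + 1"]
      by (simp add: add_divide_distrib)
  qed
qed

theorem lemma4p1:
  fixes f :: "real^'n \<Rightarrow> real" and A :: "real^'n^'l" and b :: "real^'l"
    and vv :: "(real^'n) \<times> (real^'l) \<Rightarrow> real^'w"
    and zz :: "real^'n \<Rightarrow> real^'p" and R :: "real^'p^'p"
    and \<beta> c \<sigma> :: real
    and \<tau> \<beta>s cs \<Theta> :: "int \<Rightarrow> real"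
    and x' :: "real^'n" and lam :: "real^'l"
    and xb :: "int \<Rightarrow> real^'n"
    and ut :: "int \<Rightarrow> (real^'n) \<times> (real^'l)"
    and v :: "int \<Rightarrow> real^'w" and z :: "int \<Rightarrow> real^'p"
    and Q M H G H\<^sub>0 :: "int \<Rightarrow> real^'w^'w"
  assumes f: "closed_proper_convex_on UNIV f"
    and form: "one_block_form vv \<or> two_block_form f vv \<or> multi_block_form f A vv"
    and R: "psd R"
    and "\<beta> > 0" and "c \<ge> 0" and "\<sigma> \<ge> 0"
    and \<beta>s: "\<And>k. k \<ge> 0 \<Longrightarrow> \<beta>s k = \<beta> / (\<tau> k)\<^sup>2"
    and cs: "\<And>k. k \<ge> 0 \<Longrightarrow> cs k = c * (1 - \<tau> k) * \<beta>s k / \<tau> k"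
    and \<tau>_pos: "\<And>k. k \<ge> 0 \<Longrightarrow> \<tau> k > 0"
    and \<tau>_rec: "\<And>k. k \<ge> 0 \<Longrightarrow> 1 / (\<tau> (k - 1))\<^sup>2 = (1 - \<tau> k) / (\<tau> k)\<^sup>2"
    and \<tau>_init: "\<tau> (- 1) \<in> {0<..<1}"
    and x': "x' \<in> feasible A b"
    and x_tilde: "\<And>k. k \<ge> 0 \<Longrightarrow>
      fst (ut k) = (1 / \<tau> k) *\<^sub>R xb k - ((1 - \<tau> k) / \<tau> k) *\<^sub>R xb (k - 1)"
    and prediction: "\<And>k x y. k \<ge> 0 \<Longrightarrow>
      1 / (\<tau> k)\<^sup>2 * (f x - f (xb k)) - 1 / (\<tau> (k - 1))\<^sup>2 * (f x - f (xb (k - 1)))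
        + 1 / \<tau> k * (((x, y) - ut k) \<bullet> saddle_op A b (ut k))
        + cs k * ((A *v (x - fst (ut k))) \<bullet> (A *v xb (k - 1) - b))
      \<ge> 1 / \<tau> k * ((vv (x, y) - vv (ut k)) \<bullet> (Q k *v (v k - vv (ut k)))
                     + \<sigma> / 2 * sqnorm_mat R (z k - zz x))"
    and correction: "\<And>k. k \<ge> 0 \<Longrightarrow> v (k + 1) = v k - M k *v (v k - vv (ut k))"
    and H_sym: "\<And>k. k \<ge> 0 \<Longrightarrow> transpose (H k) = H k"
    and Q: "\<And>k. k \<ge> 0 \<Longrightarrow> Q k = H k ** M k"
    and G: "\<And>k. k \<ge> 0 \<Longrightarrow> G k = transpose (Q k) + Q k - transpose (M k) ** H k ** M k"
    and H\<^sub>0: "\<And>k. k \<ge> 0 \<Longrightarrow> psd (H\<^sub>0 k)"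
    and \<Theta>_nonneg: "\<And>k. k \<ge> 0 \<Longrightarrow> \<Theta> k \<ge> 0"
    and convergence_cond: "\<And>k. k \<ge> 0 \<Longrightarrow>
      1 / \<tau> k * (sqnorm_mat (H k) (v (k + 1) - vv (x', lam))
                  + \<sigma> * sqnorm_mat R (z k - zz x')
                  - sqnorm_mat (H k) (v k - vv (x', lam))
                  + sqnorm_mat (G k) (v k - vv (ut k)))
      \<ge> sqnorm_mat (H\<^sub>0 (k + 1)) (v (k + 1) - vv (x', lam))
         - sqnorm_mat (H\<^sub>0 k) (v k - vv (x', lam)) + \<Theta> (k + 1) - \<Theta> k"
    and \<Theta>_growth: "\<And>k. k \<ge> 0 \<Longrightarrow>
      \<Theta> (k + 1) - \<Theta> k \<ge> c * \<beta>s k * (norm (A *v fst (ut k) - b))\<^sup>2"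
  shows "\<exists>C. \<forall>k\<ge>1. f (xb k) - f x' - lam \<bullet> (A *v xb k - b) \<le> C / (real_of_int k)\<^sup>2"
proof -
  define r where "r k = A *v xb k - b" for k
  define L where "L k = f (xb k) - f x' - lam \<bullet> r k" for k
  define W where "W k = sqnorm_mat (H\<^sub>0 k) (v k - vv (x', lam))" for k
  \<comment> \<open>Iteration \<open>k\<close> produces both \<open>xb k\<close> and
    \<open>v (k + 1)\<close>, so \<open>W\<close> is shifted by one; \<open>E (- 1)\<close> then
    involves only the initial data \<open>xb (- 1)\<close> and \<open>v 0\<close>.\<close>
  define E where "E k = L k / (\<tau> k)\<^sup>2 + c * \<beta> / 2 * ((norm (r k))\<^sup>2 / (\<tau> k) ^ 4) + W (k + 1) / 2"
    for k
  have Ax': "A *v x' = b"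
    using x' by (simp add: feasible_def)
  have \<tau>_pos': "\<tau> k > 0" if "k \<ge> - 1" for k
    using that \<tau>_pos[of k] \<tau>_init by (cases "k = - 1") auto

  have descent: "E k \<le> E (k - 1)" if k: "k \<ge> 0" for k
  proof -
    have t: "\<tau> k > 0" "\<tau> k \<noteq> 0" using \<tau>_pos[OF k] by auto
    define \<rho> where "\<rho> = A *v fst (ut k) - b"
    define p where "p = (1 / \<tau> k) *\<^sub>R r k"
    define q where "q = ((1 - \<tau> k) / \<tau> k) *\<^sub>R r (k - 1)"
    \<comment> \<open>The two coefficients in \<open>x_tilde\<close> differ by 1, so
      \<open>b\<close> splits along with the iterates.\<close>
    have \<rho>: "\<rho> = p - q"
    proof -
      have "b = (1 / \<tau> k) *\<^sub>R b - ((1 - \<tau> k) / \<tau> k) *\<^sub>R b"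
        using t by (simp add: field_simps flip: scaleR_left_diff_distrib)
      then show ?thesis
        by (simp add: \<rho>_def p_def q_def r_def x_tilde[OF k] matrix_vector_mult_diff_distrib
            matrix_vector_mult_scaleR scaleR_diff_right algebra_simps)
    qed

    have "(1 / \<tau> k) * (lam \<bullet> \<rho>) = lam \<bullet> r k / (\<tau> k)\<^sup>2 - (1 - \<tau> k) / (\<tau> k)\<^sup>2 * (lam \<bullet> r (k - 1))"
      by (simp add: \<rho> p_def q_def inner_diff_right right_diff_distrib power2_eq_square)
    then have multiplier: "1 / \<tau> k * (((x', lam) - ut k) \<bullet> saddle_op A b (ut k)) =
        1 / (\<tau> k)\<^sup>2 * (lam \<bullet> r k) - 1 / (\<tau> (k - 1))\<^sup>2 * (lam \<bullet> r (k - 1))"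
      by (simp add: inner_saddle_op_feasible[OF Ax'] \<tau>_rec[OF k] flip: \<rho>_def)

    have "A *v (x' - fst (ut k)) = - \<rho>"
      by (simp add: \<rho>_def matrix_vector_mult_diff_distrib Ax')
    then have "cs k * ((A *v (x' - fst (ut k))) \<bullet> (A *v xb (k - 1) - b)) = - (cs k * (\<rho> \<bullet> r (k - 1)))"
      by (simp add: r_def)
    \<comment> \<open>The factor \<open>(1 - \<tau> k) / \<tau> k\<close> in \<open>cs k\<close> is
      exactly the one that scales \<open>r (k - 1)\<close> to \<open>q\<close>.\<close>
    also have "cs k * (\<rho> \<bullet> r (k - 1)) = c * \<beta>s k * (\<rho> \<bullet> q)"
      by (simp add: cs[OF k] q_def)
    also have "\<rho> \<bullet> q = ((norm p)\<^sup>2 - (norm q)\<^sup>2 - (norm \<rho>)\<^sup>2) / 2"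
      unfolding \<rho> by (rule inner_diff_polarisation)
    also have "- (c * \<beta>s k * (((norm p)\<^sup>2 - (norm q)\<^sup>2 - (norm \<rho>)\<^sup>2) / 2)) =
        c / 2 * (\<beta>s k * (norm q)\<^sup>2) - c / 2 * (\<beta>s k * (norm p)\<^sup>2) + c * \<beta>s k * (norm \<rho>)\<^sup>2 / 2"
      by (simp add: field_simps)
    also have "\<beta>s k * (norm p)\<^sup>2 = \<beta> * ((norm (r k))\<^sup>2 / (\<tau> k) ^ 4)"
      by (simp add: p_def \<beta>s[OF k] power_divide power4_eq_xxxx power2_eq_square)
    \<comment> \<open>Squaring the recursion for \<open>\<tau>\<close> rewrites this as the penalty
      term of \<open>E (k - 1)\<close>, so the penalties telescope.\<close>
    also have "\<beta>s k * (norm q)\<^sup>2 = \<beta> * ((norm (r (k - 1)))\<^sup>2 / (\<tau> (k - 1)) ^ 4)"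
    proof -
      have "1 / (\<tau> (k - 1)) ^ 4 = (1 / (\<tau> (k - 1))\<^sup>2)\<^sup>2"
        by (simp add: power_divide)
      also have "\<dots> = (1 - \<tau> k)\<^sup>2 / (\<tau> k) ^ 4"
        unfolding \<tau>_rec[OF k] by (simp add: power_divide)
      finally have "(norm (r (k - 1)))\<^sup>2 / (\<tau> (k - 1)) ^ 4 =
          (norm (r (k - 1)))\<^sup>2 * ((1 - \<tau> k)\<^sup>2 / (\<tau> k) ^ 4)"
        by (metis mult.right_neutral times_divide_eq_right)
      moreover have "\<beta>s k * (norm q)\<^sup>2 =
          \<beta> * ((norm (r (k - 1)))\<^sup>2 * ((1 - \<tau> k)\<^sup>2 / (\<tau> k) ^ 4))"
        by (simp add: q_def \<beta>s[OF k] power_divide power_mult_distrib flip: power_add)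
      ultimately show ?thesis by simp
    qed
    finally have penalty: "cs k * ((A *v (x' - fst (ut k))) \<bullet> (A *v xb (k - 1) - b)) =
        c / 2 * (\<beta> * ((norm (r (k - 1)))\<^sup>2 / (\<tau> (k - 1)) ^ 4))
        - c / 2 * (\<beta> * ((norm (r k))\<^sup>2 / (\<tau> k) ^ 4)) + c * \<beta>s k * (norm \<rho>)\<^sup>2 / 2" .

    \<comment> \<open>Twice the bracket of the prediction inequality is the bracket of the
      convergence condition.\<close>
    have polar: "2 * ((vv (x', lam) - vv (ut k)) \<bullet> (Q k *v (v k - vv (ut k)))
          + \<sigma> / 2 * sqnorm_mat R (z k - zz x')) =
        sqnorm_mat (H k) (v (k + 1) - vv (x', lam)) + \<sigma> * sqnorm_mat R (z k - zz x')
          - sqnorm_mat (H k) (v k - vv (x', lam)) + sqnorm_mat (G k) (v k - vv (ut k))"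
      using correction_polarisation[OF H_sym[OF k] Q[OF k] G[OF k] correction[OF k],
          of "vv (x', lam)"]
      by simp
    have "W (k + 1) - W k + \<Theta> (k + 1) - \<Theta> k \<le>
        2 * (1 / \<tau> k * ((vv (x', lam) - vv (ut k)) \<bullet> (Q k *v (v k - vv (ut k)))
          + \<sigma> / 2 * sqnorm_mat R (z k - zz x')))"
      using convergence_cond[OF k] unfolding W_def polar[symmetric] mult.left_commute[of 2] .
    moreover note prediction[OF k, of x' lam, unfolded multiplier penalty]
    \<comment> \<open>Half of this growth cancels the leftover
      \<open>c * \<beta>s k * (norm \<rho>)\<^sup>2 / 2\<close> in \<open>penalty\<close>.\<close>
    moreover have "\<Theta> (k + 1) - \<Theta> k \<ge> c * \<beta>s k * (norm \<rho>)\<^sup>2"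
      using \<Theta>_growth[OF k] by (simp add: \<rho>_def)
    moreover have L: "L j / (\<tau> j)\<^sup>2 = - (1 / (\<tau> j)\<^sup>2 * (f x' - f (xb j))) - 1 / (\<tau> j)\<^sup>2 * (lam \<bullet> r j)"
      for j
      by (simp add: L_def diff_divide_distrib)
    moreover have "W (k - 1 + 1) = W k" by simp
    ultimately show ?thesis
      unfolding E_def L by argo
  qed

  have bounded: "E k \<le> E (- 1)" if "k \<ge> - 1" for k
    using that
  proof (induction k rule: int_ge_induct)
    case (step i)
    then show ?case using descent[of "i + 1"] by simp
  qed simp

  \<comment> \<open>The 4 comes from squaring \<open>\<tau> k \<le> 2 / real_of_int k\<close>. Since
    \<open>L\<close> has no definite sign, \<open>max 0\<close> supplies the nonnegative factor
    needed to multiply that bound.\<close>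
  define C where "C = 4 * max 0 (E (- 1))"
  have "L k \<le> C / (real_of_int k)\<^sup>2" if k: "k \<ge> 1" for k
  proof -
    have t: "\<tau> k > 0" using \<tau>_pos k by simp
    have "W (k + 1) \<ge> 0"
      using H\<^sub>0[of "k + 1"] k by (simp add: W_def psd_def)
    moreover have "c * \<beta> / 2 * ((norm (r k))\<^sup>2 / (\<tau> k) ^ 4) \<ge> 0"
      using \<open>\<beta> > 0\<close> \<open>c \<ge> 0\<close> by simp
    ultimately have "L k / (\<tau> k)\<^sup>2 \<le> max 0 (E (- 1))"
      using bounded[of k] k unfolding E_def by simp
    then have "L k \<le> (\<tau> k)\<^sup>2 * max 0 (E (- 1))"
      using t by (simp add: divide_le_eq mult.commute)
    moreover have "(\<tau> k)\<^sup>2 \<le> (2 / real_of_int k)\<^sup>2"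
    proof (rule power_mono)
      have "real_of_int k / 2 \<le> 1 / \<tau> k"
        using step_size_bound[of \<tau> k, OF \<tau>_pos' \<tau>_rec] k by (simp add: add_divide_distrib)
      then show "\<tau> k \<le> 2 / real_of_int k"
        using t k by (simp add: field_simps)
    qed (use t in simp)
    then have "(\<tau> k)\<^sup>2 * max 0 (E (- 1)) \<le> (2 / real_of_int k)\<^sup>2 * max 0 (E (- 1))"
      by (rule mult_right_mono) simp
    moreover have "(2 / real_of_int k)\<^sup>2 * max 0 (E (- 1)) = C / (real_of_int k)\<^sup>2"
      unfolding C_def by (simp only: power_divide) simp
    ultimately show ?thesis by linarith
  qed
  then show ?thesis
    unfolding L_def r_def by blast
qed

end
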